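(* Let $X \xrightarrow{f} Z \xleftarrow{g} Y$ be continuous maps between nonempty spaces. Then: (1) $\mathrm{TC}_H(f,g)\le \mathrm{TC}(Z)$. (2) If $Z$ is path-connected, then $$\max\{\mathrm{cat}(f),\mathrm{cat}(g)\}\le \mathrm{TC}_H(f,g)\le \mathrm{cat}(f\times g),$$ where $f\times g\colon X\times Y\to Z\times Z$ is the product map.
   Context: All maps are continuous, $I=[0,1]$, and $Z^I$ is the path space with the compact-open topology. For maps $f\colon X\to Z$, $g\colon Y\to Z$, a subset $A\subseteq X\times Y$ is $(f,g)$-sectional if there is a continuous map $\sigma\colon A\to Z^I$ with $\sigma(x,y)(0)=f(x)$ and $\sigma(x,y)(1)=g(y)$ for all $(x,y)\in A$. The homotopy bivariate topological complexity $\mathrm{TC}_H(f,g)$ is the least integer $k\ge 0$ such that $X\times Y$ can be covered by $k+1$ open $(f,g)$-sectional subsets, and $\infty$ if no such $k$ exists. The category $\mathrm{cat}(h)$ of a map $h\colon A\to B$ is the least integer $k\ge 0$ such that $A$ can be covered by $k+1$ open subsets on each of which the restriction of $h$ is null-homotopic ($\infty$ if there is none). $\mathrm{TC}(Z)$ is Farber's (reduced) topological complexity: the least integer $k\ge 0$ such that $Z\times Z$ has an open cover $U_0,\dots,U_k$ with a continuous section over each $U_i$ of $\pi_Z\colon Z^I\to Z\times Z$, $\pi_Z(\gamma)=(\gamma(0),\gamma(1))$ ($\infty$ if there is none). *)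

theory Defs
  imports "HOL-Analysis.Analysis"
begin

text \<open>Spaces are abstract topologies, so that the underlying set of a space may be any set.\<close>

text \<open>Points of a mapping space are functions that are \<^const>\<open>extensional\<close> on the domain, so that
  two of them are equal exactly when they agree on the domain. The compact set \<open>{}\<close> yields the
  whole set of maps as a subbasic open set, so no subbasis element has to be added.\<close>

definition compact_open_topology :: "'a topology \<Rightarrow> 'b topology \<Rightarrow> ('a \<Rightarrow> 'b) topology" where
  "compact_open_topology X Y =
     topology_generated_by
       {{\<gamma> \<in> extensional (topspace X). continuous_map X Y \<gamma> \<and> \<gamma> ` K \<subseteq> V} | K V.
          compactin X K \<and> openin Y V}"

lemma topspace_compact_open_topology:
  "topspace (compact_open_topology X Y) = {\<gamma> \<in> extensional (topspace X). continuous_map X Y \<gamma>}"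
proof -
  have "{\<gamma> \<in> extensional (topspace X). continuous_map X Y \<gamma>}
        \<in> {{\<gamma> \<in> extensional (topspace X). continuous_map X Y \<gamma> \<and> \<gamma> ` K \<subseteq> V} | K V.
            compactin X K \<and> openin Y V}"
    by (auto intro!: exI[of _ "{}"])
  then show ?thesis
    unfolding compact_open_topology_def topology_generated_by_topspace by blast
qed

definition path_space :: "'c topology \<Rightarrow> (real \<Rightarrow> 'c) topology" where
  "path_space Z = compact_open_topology (top_of_set {0..1}) Z"

definition endpoints :: "(real \<Rightarrow> 'c) \<Rightarrow> 'c \<times> 'c" where
  "endpoints \<gamma> = (\<gamma> 0, \<gamma> 1)"

text \<open>The least \<open>k\<close> such that \<open>X\<close> is covered by \<open>k + 1\<close> open subsets satisfying \<open>P\<close>. The members of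
  a cover may be empty or repeated. The infimum of the empty set in \<^typ>\<open>enat\<close> is \<open>\<infinity>\<close>.\<close>

definition open_cover_number :: "'a topology \<Rightarrow> ('a set \<Rightarrow> bool) \<Rightarrow> enat" where
  "open_cover_number X P =
     Inf {enat k | k. \<exists>U :: nat \<Rightarrow> 'a set.
            (\<forall>i\<le>k. openin X (U i) \<and> P (U i)) \<and> (\<Union>i\<le>k. U i) = topspace X}"

definition sectional ::
  "'a topology \<Rightarrow> 'b topology \<Rightarrow> 'c topology \<Rightarrow> ('a \<Rightarrow> 'c) \<Rightarrow> ('b \<Rightarrow> 'c) \<Rightarrow> ('a \<times> 'b) set \<Rightarrow> bool" where
  "sectional X Y Z f g A \<longleftrightarrow>
     A \<subseteq> topspace X \<times> topspace Y \<and>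
     (\<exists>\<sigma>. continuous_map (subtopology (prod_topology X Y) A) (path_space Z) \<sigma> \<and>
          (\<forall>(x, y) \<in> A. \<sigma> (x, y) 0 = f x \<and> \<sigma> (x, y) 1 = g y))"

definition TC_H ::
  "'a topology \<Rightarrow> 'b topology \<Rightarrow> 'c topology \<Rightarrow> ('a \<Rightarrow> 'c) \<Rightarrow> ('b \<Rightarrow> 'c) \<Rightarrow> enat" where
  "TC_H X Y Z f g = open_cover_number (prod_topology X Y) (sectional X Y Z f g)"

definition TC :: "'c topology \<Rightarrow> enat" where
  "TC Z = open_cover_number (prod_topology Z Z)
     (\<lambda>U. \<exists>s. continuous_map (subtopology (prod_topology Z Z) U) (path_space Z) s \<and>
              (\<forall>p\<in>U. endpoints (s p) = p))"

definition null_homotopic :: "'a topology \<Rightarrow> 'b topology \<Rightarrow> ('a \<Rightarrow> 'b) \<Rightarrow> bool" where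
  "null_homotopic A B h \<longleftrightarrow>
     (\<exists>c \<in> topspace B. homotopic_with (\<lambda>_. True) A B h (\<lambda>_. c))"

definition cat :: "'a topology \<Rightarrow> 'b topology \<Rightarrow> ('a \<Rightarrow> 'b) \<Rightarrow> enat" where
  "cat A B h = open_cover_number A (\<lambda>U. null_homotopic (subtopology A U) B h)"

end

theory Submission
  imports Defs
begin

text \<open>By the exponential law for the compact-open topology on maps out of the interval, a continuous
  map from \<open>A\<close> to the path space of \<open>Z\<close> is the same as a homotopy of maps from \<open>A\<close> to \<open>Z\<close>. Hence
  \<open>A \<subseteq> X \<times> Y\<close> is \<open>(f, g)\<close>-sectional exactly when the maps \<open>(x, y) \<mapsto> f x\<close> and \<open>(x, y) \<mapsto> g y\<close> are
  homotopic on \<open>A\<close> (\<open>sectional_iff_homotopic\<close>).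

  All the inequalities are then obtained by pulling back open covers along a continuous map
  (\<open>open_cover_number_pullback\<close>). Composing a local section of \<open>Z\<^sup>I \<rightarrow> Z \<times> Z\<close> with \<open>f \<times> g\<close> shows that
  the pulled back set is sectional, which bounds the bivariate complexity by that of \<open>Z\<close>.
  Pulling back along \<open>x \<mapsto> (x, y\<^sub>0)\<close> turns the homotopy on a sectional set into a homotopy from \<open>f\<close>
  to the constant \<open>g y\<^sub>0\<close>, and symmetrically for \<open>g\<close>, which gives the lower bounds.
  Finally, if \<open>f \<times> g\<close> is homotopic on \<open>A\<close> to a constant \<open>(c, d)\<close>, a path in \<open>Z\<close> from \<open>c\<close> to \<open>d\<close> joins
  the two components of the homotopy, so that \<open>A\<close> is sectional.\<close>

section \<open>The exponential law for the compact-open topology\<close>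

text \<open>Currying is continuous for every \<open>T\<close>: by the tube lemma, the points \<open>a\<close> for which \<open>h\<close> maps
  \<open>K \<times> {a}\<close> into \<open>V\<close> form an open set when \<open>K\<close> is compact. The restriction makes the values
  extensional, as points of the mapping space are.\<close>

lemma continuous_map_curry:
  assumes h: "continuous_map (prod_topology T A) Z h"
  shows "continuous_map A (compact_open_topology T Z)
           (\<lambda>a. restrict (\<lambda>t. h (t, a)) (topspace T))"
proof -
  let ?c = "\<lambda>a. restrict (\<lambda>t. h (t, a)) (topspace T)"
  let ?M = "\<lambda>K V. {\<gamma> \<in> extensional (topspace T). continuous_map T Z \<gamma> \<and> \<gamma> ` K \<subseteq> V}"
  have cts: "continuous_map T Z (?c a)" if "a \<in> topspace A" for a
  proof -
    have "continuous_map T Z (h \<circ> (\<lambda>t. (t, a)))"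
      by (rule continuous_map_compose [OF _ h]) (simp add: continuous_map_pairwise o_def that)
    then show ?thesis
      by (rule continuous_map_eq) simp
  qed
  show ?thesis
    unfolding compact_open_topology_def
  proof (rule continuous_on_generated_topo)
    fix U assume "U \<in> {?M K V | K V. compactin T K \<and> openin Z V}"
    then obtain K V where U: "U = ?M K V" and K: "compactin T K" and V: "openin Z V"
      by blast
    have KT: "K \<subseteq> topspace T"
      using K by (simp add: compactin_subset_topspace)
    define W where "W = {p \<in> topspace (prod_topology T A). h p \<in> V}"
    have W: "openin (prod_topology T A) W"
      unfolding W_def by (rule openin_continuous_map_preimage [OF h V])
    have eq: "?c -` U \<inter> topspace A = {a \<in> topspace A. K \<times> {a} \<subseteq> W}"
      using KT cts by (auto simp: U W_def image_subset_iff)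
    show "openin A (?c -` U \<inter> topspace A)"
      unfolding eq
    proof (subst openin_subopen, intro ballI)
      fix a assume "a \<in> {a \<in> topspace A. K \<times> {a} \<subseteq> W}"
      then obtain B C where BC: "openin T B" "openin A C" "K \<subseteq> B" "a \<in> C" "B \<times> C \<subseteq> W"
        using tube_lemma_left [OF W K, of a] by auto
      then have "C \<subseteq> {a \<in> topspace A. K \<times> {a} \<subseteq> W}"
        using openin_subset [OF BC(2)] by auto
      then show "\<exists>C. openin A C \<and> a \<in> C \<and> C \<subseteq> {a \<in> topspace A. K \<times> {a} \<subseteq> W}"
        using BC by blast
    qed
  next
    \<comment> \<open>The compact set \<open>{}\<close> imposes no condition, so one subbasic set is the whole mapping space.\<close>
    have "?M {} {} \<in> {?M K V | K V. compactin T K \<and> openin Z V}"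
      by (auto intro!: exI[of _ "{}"])
    moreover have "?c ` topspace A \<subseteq> ?M {} {}"
      using cts by auto
    ultimately show "?c ` topspace A \<subseteq> \<Union> {?M K V | K V. compactin T K \<and> openin Z V}"
      by blast
  qed
qed

text \<open>Local compactness of \<open>T\<close> provides, around each \<open>t\<close> with \<open>s a t \<in> V\<close>, a compact neighbourhood
  \<open>K\<close> that \<open>s a\<close> still maps into \<open>V\<close>; the maps with this property form a subbasic open set.\<close>

lemma continuous_map_uncurry:
  assumes T: "neighbourhood_base_of (compactin T) T"
    and s: "continuous_map A (compact_open_topology T Z) s"
  shows "continuous_map (prod_topology T A) Z (\<lambda>(t, a). s a t)"
proof -
  let ?M = "\<lambda>K V. {\<gamma> \<in> extensional (topspace T). continuous_map T Z \<gamma> \<and> \<gamma> ` K \<subseteq> V}"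
  have cts: "continuous_map T Z (s a)" if "a \<in> topspace A" for a
    using continuous_map_image_subset_topspace [OF s] that
    by (auto simp: topspace_compact_open_topology)
  show ?thesis
    unfolding continuous_map
  proof (intro conjI allI impI)
    show "(\<lambda>(t, a). s a t) ` topspace (prod_topology T A) \<subseteq> topspace Z"
      using continuous_map_image_subset_topspace [OF cts] by auto
  next
    fix V assume V: "openin Z V"
    let ?P = "{p \<in> topspace (prod_topology T A). (case p of (t, a) \<Rightarrow> s a t) \<in> V}"
    have "\<exists>B C. openin T B \<and> openin A C \<and> t \<in> B \<and> a \<in> C \<and> B \<times> C \<subseteq> ?P"
      if "(t, a) \<in> ?P" for t a
    proof -
      have ta: "t \<in> topspace T" "a \<in> topspace A" "s a t \<in> V"
        using that by auto
      have "openin T {t \<in> topspace T. s a t \<in> V}"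
        using openin_continuous_map_preimage [OF cts V] ta by simp
      then obtain B K where BK: "openin T B" "compactin T K" "t \<in> B" "B \<subseteq> K"
          "K \<subseteq> {t \<in> topspace T. s a t \<in> V}"
        using T ta unfolding neighbourhood_base_of by (metis (mono_tags, lifting) mem_Collect_eq)
      have "openin (compact_open_topology T Z) (?M K V)"
        unfolding compact_open_topology_def
        by (rule topology_generated_by_Basis) (use BK V in blast)
      then have "openin A {a \<in> topspace A. s a \<in> ?M K V}"
        by (rule openin_continuous_map_preimage [OF s])
      moreover have "a \<in> {a \<in> topspace A. s a \<in> ?M K V}"
        using continuous_map_image_subset_topspace [OF s] ta BK(5)
        by (auto simp: topspace_compact_open_topology)
      moreover have "B \<times> {a \<in> topspace A. s a \<in> ?M K V} \<subseteq> ?P"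
        using BK openin_subset [OF BK(1)] by (auto simp: image_subset_iff)
      ultimately show ?thesis
        using BK by blast
    qed
    then show "openin (prod_topology T A) ?P"
      unfolding openin_prod_topology_alt by blast
  qed
qed

lemma neighbourhood_base_of_compactin_interval:
  "neighbourhood_base_of (compactin (top_of_set {0..1::real})) (top_of_set {0..1})"
proof -
  have "compact_space (top_of_set {0..1::real})"
    by (simp add: compact_space_subtopology)
  moreover have "Hausdorff_space (top_of_set {0..1::real})"
    by (simp add: Hausdorff_space_subtopology)
  ultimately show ?thesis
    using compact_imp_locally_compact_space locally_compact_space_neighbourhood_base by blast
qed

lemma homotopic_iff_path_space_map:
  fixes A :: "'a topology" and Z :: "'b topology"
  shows "homotopic_with (\<lambda>_. True) A Z p q \<longleftrightarrow>
     (\<exists>\<sigma>. continuous_map A (path_space Z) \<sigma> \<and>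
          (\<forall>a \<in> topspace A. \<sigma> a 0 = p a \<and> \<sigma> a 1 = q a))"
    (is "?L \<longleftrightarrow> ?R")
proof
  assume ?L
  then obtain h :: "real \<times> 'a \<Rightarrow> 'b"
    where h: "continuous_map (prod_topology (top_of_set {0..1}) A) Z h"
      "\<And>x. h (0, x) = p x" "\<And>x. h (1, x) = q x"
    unfolding homotopic_with_def by blast
  show ?R
    using continuous_map_curry [OF h(1)] h(2,3) unfolding path_space_def
    by (intro exI conjI) (assumption, simp)
next
  assume ?R
  then obtain \<sigma> where \<sigma>: "continuous_map A (path_space Z) \<sigma>"
      "\<And>a. a \<in> topspace A \<Longrightarrow> \<sigma> a 0 = p a \<and> \<sigma> a 1 = q a"
    by blast
  have "continuous_map (prod_topology (top_of_set {0..1}) A) Z (\<lambda>(t, a). \<sigma> a t)"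
    using continuous_map_uncurry [OF neighbourhood_base_of_compactin_interval] \<sigma>(1)
    unfolding path_space_def by blast
  with \<sigma>(2) show ?L
    by (subst homotopic_with) auto
qed

section \<open>Sectional sets and covers\<close>

lemma sectional_iff_homotopic:
  "sectional X Y Z f g A \<longleftrightarrow>
     A \<subseteq> topspace X \<times> topspace Y \<and>
     homotopic_with (\<lambda>_. True) (subtopology (prod_topology X Y) A) Z (f \<circ> fst) (g \<circ> snd)"
proof -
  have "topspace (subtopology (prod_topology X Y) A) = A" if "A \<subseteq> topspace X \<times> topspace Y"
    using that by auto
  then show ?thesis
    unfolding sectional_def homotopic_iff_path_space_map by (auto simp: case_prod_unfold)
qed

lemma open_cover_number_pullback:
  assumes \<phi>: "continuous_map X X' \<phi>"
    and PQ: "\<And>V. openin X' V \<Longrightarrow> Q V \<Longrightarrow> P {x \<in> topspace X. \<phi> x \<in> V}"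
  shows "open_cover_number X P \<le> open_cover_number X' Q"
  unfolding open_cover_number_def
proof (rule Inf_superset_mono, clarify)
  fix k :: nat and U
  assume U: "\<forall>i\<le>k. openin X' (U i) \<and> Q (U i)" and cover: "(\<Union>i\<le>k. U i) = topspace X'"
  let ?U = "\<lambda>i. {x \<in> topspace X. \<phi> x \<in> U i}"
  have "\<phi> x \<in> (\<Union>i\<le>k. U i)" if "x \<in> topspace X" for x
    unfolding cover using continuous_map_image_subset_topspace [OF \<phi>] that by blast
  then have "(\<Union>i\<le>k. ?U i) = topspace X"
    by auto
  moreover have "\<forall>i\<le>k. openin X (?U i) \<and> P (?U i)"
    using U PQ openin_continuous_map_preimage [OF \<phi>] by blast
  ultimately show "\<exists>k'. enat k = enat k' \<and>
      (\<exists>U. (\<forall>i\<le>k'. openin X (U i) \<and> P (U i)) \<and> (\<Union>i\<le>k'. U i) = topspace X)"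
    by (intro exI [of _ k] exI [of _ ?U] conjI refl)
qed

section \<open>Bounds on the bivariate complexity\<close>

lemma TC_H_le_TC:
  assumes f: "continuous_map X Z f" and g: "continuous_map Y Z g"
  shows "TC_H X Y Z f g \<le> TC Z"
  unfolding TC_H_def TC_def
proof (rule open_cover_number_pullback)
  show fg: "continuous_map (prod_topology X Y) (prod_topology Z Z) (map_prod f g)"
    using f g by (simp add: map_prod_def continuous_map_prod_top)
  fix V
  assume "\<exists>s. continuous_map (subtopology (prod_topology Z Z) V) (path_space Z) s \<and>
              (\<forall>p\<in>V. endpoints (s p) = p)"
  then obtain s where s: "continuous_map (subtopology (prod_topology Z Z) V) (path_space Z) s"
      "\<And>p. p \<in> V \<Longrightarrow> endpoints (s p) = p"
    by blast
  let ?A = "{p \<in> topspace (prod_topology X Y). map_prod f g p \<in> V}"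
  have "continuous_map (subtopology (prod_topology X Y) ?A) (subtopology (prod_topology Z Z) V)
          (map_prod f g)"
    using fg by (auto simp: continuous_map_in_subtopology continuous_map_from_subtopology)
  then have "continuous_map (subtopology (prod_topology X Y) ?A) (path_space Z) (s \<circ> map_prod f g)"
    using s(1) by (rule continuous_map_compose)
  moreover have "(s \<circ> map_prod f g) (x, y) 0 = f x \<and> (s \<circ> map_prod f g) (x, y) 1 = g y"
    if "(x, y) \<in> ?A" for x y
    using s(2) [of "(f x, g y)"] that by (simp add: endpoints_def)
  moreover have "?A \<subseteq> topspace X \<times> topspace Y"
    by auto
  ultimately show "sectional X Y Z f g ?A"
    unfolding sectional_def by (intro conjI exI [of _ "s \<circ> map_prod f g"]) auto
qed

lemma homotopic_pullback_sectional:
  assumes "sectional X Y Z f g V"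
    and \<phi>: "continuous_map W (prod_topology X Y) \<phi>" and U: "U = {w \<in> topspace W. \<phi> w \<in> V}"
  shows "homotopic_with (\<lambda>_. True) (subtopology W U) Z (f \<circ> fst \<circ> \<phi>) (g \<circ> snd \<circ> \<phi>)"
proof (rule homotopic_with_compose_continuous_map_right)
  show "homotopic_with (\<lambda>_. True) (subtopology (prod_topology X Y) V) Z (f \<circ> fst) (g \<circ> snd)"
    using assms(1) by (simp add: sectional_iff_homotopic)
  show "continuous_map (subtopology W U) (subtopology (prod_topology X Y) V) \<phi>"
    using \<phi> U by (auto simp: continuous_map_in_subtopology continuous_map_from_subtopology)
qed simp

lemma cat_left_le_TC_H:
  assumes "topspace Y \<noteq> {}" and g: "continuous_map Y Z g"
  shows "cat X Z f \<le> TC_H X Y Z f g"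
proof -
  obtain y where y: "y \<in> topspace Y"
    using assms(1) by blast
  have \<phi>: "continuous_map X (prod_topology X Y) (\<lambda>x. (x, y))"
    using y by (simp add: continuous_map_pairwise o_def)
  have "null_homotopic (subtopology X {x \<in> topspace X. (x, y) \<in> V}) Z f"
    if "sectional X Y Z f g V" for V
    using homotopic_pullback_sectional [OF that \<phi> refl] y
      continuous_map_image_subset_topspace [OF g]
    by (auto simp: null_homotopic_def o_def)
  then show ?thesis
    unfolding cat_def TC_H_def by (intro open_cover_number_pullback [OF \<phi>])
qed

lemma cat_right_le_TC_H:
  assumes "topspace X \<noteq> {}" and f: "continuous_map X Z f"
  shows "cat Y Z g \<le> TC_H X Y Z f g"
proof -
  obtain x where x: "x \<in> topspace X"
    using assms(1) by blast
  have \<phi>: "continuous_map Y (prod_topology X Y) (Pair x)"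
    using x by (simp add: continuous_map_pairwise o_def)
  have "null_homotopic (subtopology Y {y \<in> topspace Y. (x, y) \<in> V}) Z g"
    if "sectional X Y Z f g V" for V
    using homotopic_with_symD [OF homotopic_pullback_sectional [OF that \<phi> refl]] x
      continuous_map_image_subset_topspace [OF f]
    by (auto simp: null_homotopic_def o_def)
  then show ?thesis
    unfolding cat_def TC_H_def by (intro open_cover_number_pullback [OF \<phi>])
qed

lemma TC_H_le_cat_map_prod:
  assumes Z: "path_connected_space Z"
  shows "TC_H X Y Z f g \<le> cat (prod_topology X Y) (prod_topology Z Z) (map_prod f g)"
  unfolding TC_H_def cat_def
proof (rule open_cover_number_pullback)
  show "continuous_map (prod_topology X Y) (prod_topology X Y) (\<lambda>p. p)"
    by simp
  fix V
  assume V: "openin (prod_topology X Y) V"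
    and "null_homotopic (subtopology (prod_topology X Y) V) (prod_topology Z Z) (map_prod f g)"
  then obtain c d where cd: "c \<in> topspace Z" "d \<in> topspace Z"
    and H: "homotopic_with (\<lambda>_. True) (subtopology (prod_topology X Y) V) (prod_topology Z Z)
              (map_prod f g) (\<lambda>_. (c, d))"
    unfolding null_homotopic_def by auto
  have "homotopic_with (\<lambda>_. True) (subtopology (prod_topology X Y) V) Z
          (fst \<circ> map_prod f g) (fst \<circ> (\<lambda>_. (c, d)))"
    by (rule homotopic_with_compose_continuous_map_left [OF H]) (auto simp: continuous_map_fst)
  then have 1: "homotopic_with (\<lambda>_. True) (subtopology (prod_topology X Y) V) Z (f \<circ> fst) (\<lambda>_. c)"
    by (simp add: o_def)
  have "homotopic_with (\<lambda>_. True) (subtopology (prod_topology X Y) V) Z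
          (snd \<circ> map_prod f g) (snd \<circ> (\<lambda>_. (c, d)))"
    by (rule homotopic_with_compose_continuous_map_left [OF H]) (auto simp: continuous_map_snd)
  then have 2: "homotopic_with (\<lambda>_. True) (subtopology (prod_topology X Y) V) Z (g \<circ> snd) (\<lambda>_. d)"
    by (simp add: o_def)
  \<comment> \<open>Only here is path-connectedness needed: a path from \<open>c\<close> to \<open>d\<close> links the two homotopies.\<close>
  have "homotopic_with (\<lambda>_. True) (subtopology (prod_topology X Y) V) Z (\<lambda>_. c) (\<lambda>_. d)"
    using Z cd by (simp add: homotopic_constant_maps path_connected_space_iff_path_component)
  then have "homotopic_with (\<lambda>_. True) (subtopology (prod_topology X Y) V) Z
               (f \<circ> fst) (g \<circ> snd)"
    using homotopic_with_trans [OF 1] homotopic_with_trans [OF _ homotopic_with_symD [OF 2]] by blast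
  moreover have "V \<subseteq> topspace X \<times> topspace Y"
    using openin_subset [OF V] by simp
  moreover have "{p \<in> topspace (prod_topology X Y). p \<in> V} = V"
    using openin_subset [OF V] by blast
  ultimately show "sectional X Y Z f g {p \<in> topspace (prod_topology X Y). p \<in> V}"
    by (simp only: sectional_iff_homotopic)
qed

theorem proposition8p3:
  fixes X :: "'a topology" and Y :: "'b topology" and Z :: "'c topology"
    and f :: "'a \<Rightarrow> 'c" and g :: "'b \<Rightarrow> 'c"
  assumes "topspace X \<noteq> {}" and "topspace Y \<noteq> {}" and "topspace Z \<noteq> {}"
    and "continuous_map X Z f" and "continuous_map Y Z g"
  shows "TC_H X Y Z f g \<le> TC Z \<and>
         (path_connected_space Z \<longrightarrow>
            max (cat X Z f) (cat Y Z g) \<le> TC_H X Y Z f g \<and>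
            TC_H X Y Z f g \<le> cat (prod_topology X Y) (prod_topology Z Z) (map_prod f g))"
  using TC_H_le_TC [OF assms(4,5)] cat_left_le_TC_H [OF assms(2,5), of X f]
    cat_right_le_TC_H [OF assms(1,4), of Y g] TC_H_le_cat_map_prod [of Z X Y f g]
  by simp

end
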